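(* Let $d\ge 1$ and let $n_1,\dots,n_d$ be positive integers. Then, as $t\to\infty$, \[\pi_t^*(K_{n_1}\Box K_{n_2}\Box\cdots\Box K_{n_d})\in 2^d t\prod_{i=1}^d\frac{n_i}{n_i+1}+\Theta(1),\] i.e. the difference $\pi_t^*(K_{n_1}\Box\cdots\Box K_{n_d})-2^d t\prod_{i=1}^d\frac{n_i}{n_i+1}$ is bounded by a constant independent of $t$.
   Context: A distribution on a graph $G=(V,E)$ is a function $D:V\to\mathbb{N}$, with size $|D|=\sum_v D(v)$. A pebbling move removes two pebbles from a vertex having at least two pebbles and places one pebble on a neighbor. A distribution $D$ is $t$-solvable if for every vertex $v$, some sequence of pebbling moves starting from $D$ results in a distribution with at least $t$ pebbles on $v$. The optimal $t$-pebbling number $\pi_t^*(G)$ is the minimum size of a $t$-solvable distribution on $G$. $K_n$ is the complete graph on $n$ vertices and $\Box$ is the Cartesian product of graphs. *)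

theory Defs
  imports Complex_Main "HOL-Library.FuncSet" "Graph_Theory.Graph_Theory"
begin

text \<open>
  Finite simple graphs are the graphs of the locale \<^locale>\<open>pair_graph\<close>: finite, symmetric,
  loop-free. The complete graph is the library's \<^const>\<open>complete_digraph\<close>, which
  characterizes the complete graphs on \<open>n\<close> vertices over an arbitrary vertex type.
\<close>

section \<open>Cartesian products of finitely many graphs\<close>

text \<open>
  A vertex is a tuple, represented as an extensional function on the index set. Two tuples are
  adjacent if they are adjacent in one coordinate and agree in all others.
\<close>

definition cartesian_product :: "'i set \<Rightarrow> ('i \<Rightarrow> 'a pair_pre_digraph) \<Rightarrow> ('i \<Rightarrow> 'a) pair_pre_digraph" where
  "cartesian_product I G =
    \<lparr> pverts = (\<Pi>\<^sub>E i\<in>I. pverts (G i)),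
      parcs = {(x, y). x \<in> (\<Pi>\<^sub>E i\<in>I. pverts (G i)) \<and> y \<in> (\<Pi>\<^sub>E i\<in>I. pverts (G i)) \<and>
        (\<exists>i\<in>I. (x i, y i) \<in> parcs (G i) \<and> (\<forall>j\<in>I - {i}. x j = y j))} \<rparr>"

section \<open>Pebbling\<close>

text \<open>
  A distribution is a function from the vertices to the natural numbers, extended by \<open>0\<close>
  outside the vertex set.
\<close>

definition distribution :: "'a pair_pre_digraph \<Rightarrow> ('a \<Rightarrow> nat) \<Rightarrow> bool" where
  "distribution G D \<longleftrightarrow> (\<forall>v. v \<notin> pverts G \<longrightarrow> D v = 0)"

definition distribution_size :: "'a pair_pre_digraph \<Rightarrow> ('a \<Rightarrow> nat) \<Rightarrow> nat" where
  "distribution_size G D = (\<Sum>v\<in>pverts G. D v)"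

text \<open>The graphs considered have no loops, so the two updated vertices are distinct.\<close>

definition pebbling_move :: "'a pair_pre_digraph \<Rightarrow> ('a \<Rightarrow> nat) \<Rightarrow> ('a \<Rightarrow> nat) \<Rightarrow> bool" where
  "pebbling_move G D D' \<longleftrightarrow>
    (\<exists>u v. (u, v) \<in> parcs G \<and> 2 \<le> D u \<and> D' = D(u := D u - 2, v := D v + 1))"

definition t_solvable :: "'a pair_pre_digraph \<Rightarrow> nat \<Rightarrow> ('a \<Rightarrow> nat) \<Rightarrow> bool" where
  "t_solvable G t D \<longleftrightarrow> (\<forall>v\<in>pverts G. \<exists>D'. (pebbling_move G)\<^sup>*\<^sup>* D D' \<and> t \<le> D' v)"

definition optimal_pebbling_number :: "nat \<Rightarrow> 'a pair_pre_digraph \<Rightarrow> nat" (\<open>\<pi>\<^sup>*\<close>) where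
  "\<pi>\<^sup>* t G = (LEAST m. \<exists>D. distribution G D \<and> t_solvable G t D \<and> distribution_size G D = m)"

section \<open>Well-definedness\<close>

lemma pair_graph_cartesian_product:
  assumes "finite I" and "\<And>i. i \<in> I \<Longrightarrow> pair_graph (G i)"
  shows "pair_graph (cartesian_product I G)"
proof -
  let ?V = "\<Pi>\<^sub>E i\<in>I. pverts (G i)"
  have fin: "finite ?V"
    using assms by (intro finite_PiE) (auto simp: pair_graph_def pair_digraph_def pair_fin_digraph.pair_finite_verts)
  have sub: "parcs (cartesian_product I G) \<subseteq> ?V \<times> ?V"
    by (auto simp: cartesian_product_def)
  have symG: "(b, a) \<in> parcs (G i)" if "i \<in> I" "(a, b) \<in> parcs (G i)" for i a b
  proof -
    interpret pair_graph "G i" using assms that by simp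
    show ?thesis using that(2) pair_sym_arcs by (auto simp: symmetric_def dest: symD)
  qed
  have loopG: "(a, a) \<notin> parcs (G i)" if "i \<in> I" for i a
  proof -
    interpret pair_graph "G i" using assms that by simp
    show ?thesis using pair_no_loops by force
  qed
  have "symmetric (with_proj (cartesian_product I G))"
    by (auto simp: symmetric_def cartesian_product_def intro!: symI)
      (metis DiffI insert_iff singletonD symG)
  moreover have "fst e \<noteq> snd e" if "e \<in> parcs (cartesian_product I G)" for e
    using that loopG by (auto simp: cartesian_product_def)
  moreover have "finite (parcs (cartesian_product I G))"
    using fin sub by (meson finite_SigmaI finite_subset)
  ultimately show ?thesis
    using fin sub by unfold_locales (auto simp: cartesian_product_def)
qed

lemma optimal_pebbling_number_attained:
  "\<exists>D. distribution G D \<and> t_solvable G t D \<and> distribution_size G D = \<pi>\<^sup>* t G"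
proof -
  let ?D = "\<lambda>v. if v \<in> pverts G then t else 0"
  have "distribution G ?D" "t_solvable G t ?D"
    by (auto simp: distribution_def t_solvable_def intro!: exI[of _ ?D])
  then have "\<exists>m D. distribution G D \<and> t_solvable G t D \<and> distribution_size G D = m" by blast
  then show ?thesis unfolding optimal_pebbling_number_def by (rule LeastI_ex)
qed

end

theory Submission
  imports Defs
begin

text \<open>
  Let \<open>h u v\<close> be the number of coordinates in which \<open>u\<close> and \<open>v\<close> differ and put
  \<open>W v u = 2 ^ (d - h u v)\<close>. A pebbling move does not increase \<open>\<Sum>u. D u * W v u\<close>, so a \<open>t\<close>-solvable
  \<open>D\<close> has \<open>\<Sum>u. D u * W v u \<ge> t * 2 ^ d\<close> for every \<open>v\<close>. Since \<open>\<Sum>v. W v u = (\<Prod>i. n i + 1)\<close>, summing over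
  \<open>v\<close> yields the lower bound, with no error term. Conversely, if every vertex carries \<open>2 ^ d * m\<close>
  pebbles, then each \<open>u\<close> can send \<open>m * W v u\<close> of them to \<open>v\<close> without rounding loss, so \<open>v\<close>
  receives \<open>m * (\<Prod>i. n i + 1)\<close>. Take for \<open>m\<close> the least integer with \<open>t \<le> m * (\<Prod>i. n i + 1)\<close>.
\<close>

lemma (in pair_digraph) pebbling_move_weight_le:
  assumes "\<And>u v. (u, v) \<in> parcs G \<Longrightarrow> w v \<le> 2 * w u" and "pebbling_move G D D'"
  shows "(\<Sum>x\<in>pverts G. D' x * w x) \<le> (\<Sum>x\<in>pverts G. D x * w x)"
proof -
  obtain u v where uv: "(u, v) \<in> parcs G" "2 \<le> D u" "D' = D(u := D u - 2, v := D v + 1)"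
    using assms(2) by (auto simp: pebbling_move_def)
  have "u \<noteq> v" and in_verts: "u \<in> pverts G" "v \<in> pverts G"
    using uv(1) pair_no_loops in_arcsD1 in_arcsD2 by fastforce+
  obtain c where c: "D u = 2 + c" using uv(2) le_Suc_ex by blast
  \<comment> \<open>The loss at \<open>u\<close> stands on the left, so the balance holds over the
    naturals without truncated subtraction. Summation then leaves only the two correction
    terms.\<close>
  have "D' x * w x + (if x = u then 2 * w u else 0) = D x * w x + (if x = v then w v else 0)" for x
    using c \<open>u \<noteq> v\<close> by (auto simp: uv(3) distrib_right)
  then have "(\<Sum>x\<in>pverts G. D' x * w x + (if x = u then 2 * w u else 0))
      = (\<Sum>x\<in>pverts G. D x * w x + (if x = v then w v else 0))" by simp
  then have "(\<Sum>x\<in>pverts G. D' x * w x) + 2 * w u = (\<Sum>x\<in>pverts G. D x * w x) + w v"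
    using in_verts pair_finite_verts by (simp add: sum.distrib)
  then show ?thesis using assms(1)[OF uv(1)] by simp
qed

lemma (in pair_digraph) pebbling_weight_le:
  assumes "\<And>u v. (u, v) \<in> parcs G \<Longrightarrow> w v \<le> 2 * w u" and "(pebbling_move G)\<^sup>*\<^sup>* D D'"
  shows "(\<Sum>x\<in>pverts G. D' x * w x) \<le> (\<Sum>x\<in>pverts G. D x * w x)"
  using assms(2)
proof induction
  case (step D' D'')
  from pebbling_move_weight_le[where w = w, OF assms(1) step(2)] step(3)
  show ?case by simp
qed simp

lemma pebbling_move_add:
  assumes "pebbling_move G D D'"
  shows "pebbling_move G (\<lambda>x. D x + E x) (\<lambda>x. D' x + E x)"
proof -
  obtain u v where uv: "(u, v) \<in> parcs G" "2 \<le> D u" "D' = D(u := D u - 2, v := D v + 1)"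
    using assms by (auto simp: pebbling_move_def)
  then show ?thesis
    unfolding pebbling_move_def by (intro exI[of _ u] exI[of _ v]) auto
qed

text \<open>Extra pebbles never block a move: first \<open>D\<close> evolves while \<open>E\<close>
  stays idle, then \<open>E\<close> evolves while \<open>D'\<close> stays idle.\<close>

lemma pebbling_moves_add:
  assumes "(pebbling_move G)\<^sup>*\<^sup>* D D'" "(pebbling_move G)\<^sup>*\<^sup>* E E'"
  shows "(pebbling_move G)\<^sup>*\<^sup>* (\<lambda>x. D x + E x) (\<lambda>x. D' x + E' x)"
proof -
  have left: "(pebbling_move G)\<^sup>*\<^sup>* (\<lambda>x. A x + F x) (\<lambda>x. A' x + F x)"
    if "(pebbling_move G)\<^sup>*\<^sup>* A A'" for A A' F
    using that by induction (auto intro: rtranclp.rtrancl_into_rtrancl pebbling_move_add)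
  show ?thesis
    using left[OF assms(1), of E] left[OF assms(2), of D'] by (simp add: add.commute)
qed

lemma pebbling_moves_sum:
  assumes "\<And>a. a \<in> A \<Longrightarrow> (pebbling_move G)\<^sup>*\<^sup>* (D a) (D' a)"
  shows "(pebbling_move G)\<^sup>*\<^sup>* (\<lambda>x. \<Sum>a\<in>A. D a x) (\<lambda>x. \<Sum>a\<in>A. D' a x)"
  using assms
  by (induction A rule: infinite_finite_induct) (auto intro: pebbling_moves_add)

lemma (in pair_loopfree_digraph) pebbling_moves_arc:
  assumes "(u, v) \<in> parcs G"
  shows "(pebbling_move G)\<^sup>*\<^sup>* ((\<lambda>_. 0)(u := 2 * m)) ((\<lambda>_. 0)(v := m))"
proof (induction m)
  case (Suc m)
  have "u \<noteq> v" using assms pair_no_loops by fastforce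
  have "pebbling_move G ((\<lambda>_. 0)(u := 2)) ((\<lambda>_. 0)(v := 1))"
    unfolding pebbling_move_def using assms \<open>u \<noteq> v\<close>
    by (intro exI[of _ u] exI[of _ v]) auto
  from pebbling_moves_add[OF Suc.IH r_into_rtranclp[of "pebbling_move G", OF this]]
  show ?case by (simp add: fun_upd_def if_distrib cong: if_cong)
qed (auto simp: fun_upd_def)

text \<open>This is \<open>W v u\<close> as a product over the coordinates: no exponents are
  subtracted, and sums over tuples factor.\<close>

definition agreement_weight :: "'i set \<Rightarrow> ('i \<Rightarrow> 'a) \<Rightarrow> ('i \<Rightarrow> 'a) \<Rightarrow> nat" where
  "agreement_weight I v u = (\<Prod>i\<in>I. if u i = v i then 2 else 1)"

lemma agreement_weight_self: "agreement_weight I v v = 2 ^ card I"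
  by (simp add: agreement_weight_def)

lemma agreement_weight_commute: "agreement_weight I v u = agreement_weight I u v"
  by (simp add: agreement_weight_def eq_commute)

text \<open>Every coordinate contributes one factor 2, to the left factor if the tuples differ there
  and to the weight if they agree.\<close>

lemma agreement_weight_hamming:
  assumes "finite I"
  shows "2 ^ card {i \<in> I. u i \<noteq> v i} * agreement_weight I v u = 2 ^ card I"
proof -
  have "2 ^ card {i \<in> I. u i \<noteq> v i} = (\<Prod>i\<in>I. if u i \<noteq> v i then 2 else 1 :: nat)"
    using assms by (simp add: prod.If_cases Int_def conj_commute)
  also have "\<dots> * agreement_weight I v u = (\<Prod>i\<in>I. 2)"
    unfolding agreement_weight_def prod.distrib[symmetric] by (intro prod.cong) auto
  finally show ?thesis by simp
qed

text \<open>Only the factor at \<open>i\<close> can change, and it is 1 or 2.\<close>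

lemma agreement_weight_adjacent:
  assumes "finite I" "i \<in> I" "\<forall>j\<in>I - {i}. x j = y j"
  shows "agreement_weight I v y \<le> 2 * agreement_weight I v x"
proof -
  have "(\<Prod>j\<in>I - {i}. if y j = v j then 2 else 1 :: nat)
      = (\<Prod>j\<in>I - {i}. if x j = v j then 2 else 1)"
    using assms(3) by (intro prod.cong) auto
  then show ?thesis
    by (simp add: agreement_weight_def prod.remove[OF assms(1,2)])
qed

text \<open>The sum of products is a product of sums; in coordinate \<open>i\<close> the entry
  \<open>v i\<close> counts twice and every other entry once.\<close>

lemma sum_agreement_weight:
  assumes "finite I" "\<And>i. i \<in> I \<Longrightarrow> finite (V i)" "v \<in> Pi\<^sub>E I V"
  shows "(\<Sum>u\<in>Pi\<^sub>E I V. agreement_weight I v u) = (\<Prod>i\<in>I. card (V i) + 1)"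
proof -
  have "(\<Sum>a\<in>V i. if a = v i then 2 else 1 :: nat) = card (V i) + 1" if "i \<in> I" for i
  proof -
    have "v i \<in> V i" using assms(3) that by auto
    have "(\<Sum>a\<in>V i. if a = v i then 2 else 1 :: nat) = (\<Sum>a\<in>V i. 1 + (if a = v i then 1 else 0))"
      by (intro sum.cong) auto
    also have "\<dots> = card (V i) + 1"
      using \<open>v i \<in> V i\<close> assms(2)[OF that] by (subst sum.distrib) simp
    finally show ?thesis .
  qed
  then show ?thesis
    unfolding agreement_weight_def
    by (subst prod_sum_PiE[symmetric]) (use assms in auto)
qed

locale complete_product =
  fixes I :: "'i set" and G :: "'i \<Rightarrow> 'a pair_pre_digraph" and n :: "'i \<Rightarrow> nat"
  assumes finite_index: "finite I"
    and complete: "\<And>i. i \<in> I \<Longrightarrow> complete_digraph (n i) (with_proj (G i))"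
begin

abbreviation "H \<equiv> cartesian_product I G"

lemma complete_factor:
  assumes "i \<in> I"
  shows "finite (pverts (G i))" "card (pverts (G i)) = n i"
    "parcs (G i) = {(u, v). u \<in> pverts (G i) \<and> v \<in> pverts (G i) \<and> u \<noteq> v}"
  using complete[OF assms] by (auto simp: complete_digraph_pair_def)

sublocale pair_graph H
  using finite_index complete
  by (intro pair_graph_cartesian_product) (auto intro: pair_graphI_complete)

lemma pverts_product: "pverts H = (\<Pi>\<^sub>E i\<in>I. pverts (G i))"
  by (simp add: cartesian_product_def)

lemma card_pverts_product: "card (pverts H) = (\<Prod>i\<in>I. n i)"
  using finite_index complete_factor(2) by (simp add: pverts_product card_PiE)

lemma sum_weight:
  assumes "v \<in> pverts H"
  shows "(\<Sum>u\<in>pverts H. agreement_weight I v u) = (\<Prod>i\<in>I. n i + 1)"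
  using sum_agreement_weight[of I "\<lambda>i. pverts (G i)" v] finite_index complete_factor(1,2) assms
  by (simp add: pverts_product)

lemma solvable_size_ge:
  assumes "t_solvable H t D"
  shows "t * 2 ^ card I * (\<Prod>i\<in>I. n i) \<le> distribution_size H D * (\<Prod>i\<in>I. n i + 1)"
proof -
  have weight: "t * 2 ^ card I \<le> (\<Sum>u\<in>pverts H. D u * agreement_weight I v u)"
    if v: "v \<in> pverts H" for v
  proof -
    obtain D' where D': "(pebbling_move H)\<^sup>*\<^sup>* D D'" "t \<le> D' v"
      using assms v by (auto simp: t_solvable_def)
    \<comment> \<open>The pebbles that reached \<open>v\<close> alone already have this much
      weight.\<close>
    have "t * 2 ^ card I \<le> D' v * agreement_weight I v v"
      using D'(2) by (simp add: agreement_weight_self)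
    also have "\<dots> \<le> (\<Sum>u\<in>pverts H. D' u * agreement_weight I v u)"
      using v pair_finite_verts by (intro member_le_sum) auto
    also have "\<dots> \<le> (\<Sum>u\<in>pverts H. D u * agreement_weight I v u)"
      using D'(1) agreement_weight_adjacent[OF finite_index]
      by (intro pebbling_weight_le) (auto simp: cartesian_product_def)
    finally show ?thesis .
  qed
  have "t * 2 ^ card I * (\<Prod>i\<in>I. n i) = (\<Sum>v\<in>pverts H. t * 2 ^ card I)"
    by (simp add: card_pverts_product)
  also have "\<dots> \<le> (\<Sum>v\<in>pverts H. \<Sum>u\<in>pverts H. D u * agreement_weight I v u)"
    by (intro sum_mono weight)
  \<comment> \<open>By symmetry of the weight, each pebble contributes the same total over all
    targets, wherever it lies.\<close>
  also have "\<dots> = (\<Sum>u\<in>pverts H. D u * (\<Sum>v\<in>pverts H. agreement_weight I u v))"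
    by (subst sum.swap) (simp add: sum_distrib_left agreement_weight_commute)
  also have "\<dots> = distribution_size H D * (\<Prod>i\<in>I. n i + 1)"
    by (simp add: sum_weight distribution_size_def sum_distrib_right)
  finally show ?thesis .
qed

text \<open>Induction on the Hamming distance: each arc corrects one coordinate and exactly halves
  the stack, since a power of 2 is factored out in advance.\<close>

lemma pebbling_moves_hamming:
  assumes "u \<in> pverts H" "v \<in> pverts H"
  shows "(pebbling_move H)\<^sup>*\<^sup>* ((\<lambda>_. 0)(u := 2 ^ card {i \<in> I. u i \<noteq> v i} * m)) ((\<lambda>_. 0)(v := m))"
  using assms(1)
proof (induction "card {i \<in> I. u i \<noteq> v i}" arbitrary: u)
  case 0
  then have "u = v"
    using finite_index assms(2) by (intro PiE_ext[of u I "\<lambda>i. pverts (G i)" v]) (auto simp: pverts_product)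
  then show ?case by simp
next
  case (Suc k)
  then have "{i \<in> I. u i \<noteq> v i} \<noteq> {}" by (metis card.empty nat.distinct(1))
  then obtain i where i: "i \<in> I" "u i \<noteq> v i" by auto
  let ?u = "u(i := v i)"
  have "{j \<in> I. ?u j \<noteq> v j} = {j \<in> I. u j \<noteq> v j} - {i}" by auto
  then have k: "k = card {j \<in> I. ?u j \<noteq> v j}"
    using Suc.hyps(2) finite_index i by simp
  have u': "?u \<in> pverts H"
    using Suc.prems assms(2) i(1) by (auto simp: pverts_product PiE_def extensional_def)
  \<comment> \<open>Completeness of the factor lets a wrong coordinate be corrected along a single
    arc.\<close>
  then have "(u, ?u) \<in> parcs H"
    using Suc.prems assms(2) i complete_factor(3)[OF i(1)]
    by (auto simp: cartesian_product_def intro!: bexI[of _ i])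
  from pebbling_moves_arc[OF this, of "2 ^ k * m"] Suc.hyps(1)[OF k u']
  show ?case
    unfolding Suc.hyps(2)[symmetric] k[symmetric] by (simp add: mult.assoc)
qed

lemma uniform_solvable:
  assumes "t \<le> m * (\<Prod>i\<in>I. n i + 1)"
  shows "t_solvable H t (\<lambda>x. if x \<in> pverts H then 2 ^ card I * m else 0)"
  unfolding t_solvable_def
proof (intro ballI exI conjI)
  fix v assume v: "v \<in> pverts H"
  let ?w = "\<lambda>u. agreement_weight I v u * m"
  \<comment> \<open>The uniform distribution is split into one stack per vertex, and each stack is
    sent to \<open>v\<close> on its own.\<close>
  have "(pebbling_move H)\<^sup>*\<^sup>* (\<lambda>x. \<Sum>u\<in>pverts H. ((\<lambda>_. 0)(u := 2 ^ card I * m)) x)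
      (\<lambda>x. \<Sum>u\<in>pverts H. ((\<lambda>_. 0)(v := ?w u)) x)"
  proof (intro pebbling_moves_sum)
    fix u assume "u \<in> pverts H"
    from pebbling_moves_hamming[OF this v, of "?w u"]
    show "(pebbling_move H)\<^sup>*\<^sup>* ((\<lambda>_. 0)(u := 2 ^ card I * m)) ((\<lambda>_. 0)(v := ?w u))"
      \<comment> \<open>With \<open>h\<close> differing coordinates,
        \<open>2 ^ h * ?w u = 2 ^ card I * m\<close>, so the whole stack is used and nothing is
        rounded.\<close>
      by (simp add: agreement_weight_hamming[OF finite_index] flip: mult.assoc)
  qed
  then show "(pebbling_move H)\<^sup>*\<^sup>* (\<lambda>x. if x \<in> pverts H then 2 ^ card I * m else 0)
      (\<lambda>x. \<Sum>u\<in>pverts H. ((\<lambda>_. 0)(v := ?w u)) x)"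
    using pair_finite_verts by (simp add: fun_upd_def)
  show "t \<le> (\<Sum>u\<in>pverts H. ((\<lambda>_. 0)(v := ?w u)) v)"
    using assms sum_weight[OF v] by (simp add: mult.commute[of m] flip: sum_distrib_right)
qed

lemma optimal_pebbling_number_le:
  assumes "t \<le> m * (\<Prod>i\<in>I. n i + 1)"
  shows "\<pi>\<^sup>* t H \<le> 2 ^ card I * m * (\<Prod>i\<in>I. n i)"
  unfolding optimal_pebbling_number_def
proof (intro Least_le exI conjI)
  show "t_solvable H t (\<lambda>x. if x \<in> pverts H then 2 ^ card I * m else 0)"
    by (rule uniform_solvable[OF assms])
qed (auto simp: distribution_def distribution_size_def card_pverts_product)

lemma optimal_pebbling_number_bounds:
  fixes t :: nat and a :: real
  defines "a \<equiv> 2 ^ card I * real t * (\<Prod>i\<in>I. real (n i) / (real (n i) + 1))"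
  shows "a \<le> real (\<pi>\<^sup>* t H)" "real (\<pi>\<^sup>* t H) \<le> a + 2 ^ card I * (\<Prod>i\<in>I. real (n i))"
proof -
  define P where "P = (\<Prod>i\<in>I. n i)"
  define Q where "Q = (\<Prod>i\<in>I. n i + 1)"
  have "Q > 0" using finite_index by (auto simp: Q_def)
  have a: "a = 2 ^ card I * real t * real P / real Q"
    by (simp add: a_def P_def Q_def prod_dividef add.commute)
  obtain D where D: "t_solvable H t D" "distribution_size H D = \<pi>\<^sup>* t H"
    using optimal_pebbling_number_attained by blast
  have "t * 2 ^ card I * P \<le> \<pi>\<^sup>* t H * Q"
    using solvable_size_ge[OF D(1)] by (simp only: D(2) P_def Q_def)
  then have "real (t * 2 ^ card I * P) \<le> real (\<pi>\<^sup>* t H * Q)" by (simp only: of_nat_le_iff)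
  then show "a \<le> real (\<pi>\<^sup>* t H)"
    using \<open>Q > 0\<close> by (simp add: a field_simps)
  \<comment> \<open>Rounding up raises \<open>m\<close> by at most 1 over \<open>t / Q\<close>, and
    one unit of \<open>m\<close> costs \<open>2 ^ card I * P\<close> pebbles: this is the whole
    error term.\<close>
  define m where "m = nat \<lceil>real t / real Q\<rceil>"
  have m: "real t / real Q \<le> real m" "real m \<le> real t / real Q + 1"
    by (simp_all add: m_def)
  have "real t \<le> real (m * Q)" using m(1) \<open>Q > 0\<close> by (simp add: field_simps)
  then have "t \<le> m * Q" by (simp only: of_nat_le_iff)
  then have "real (\<pi>\<^sup>* t H) \<le> real (2 ^ card I * m * P)"
    using optimal_pebbling_number_le[of t m] by (simp only: of_nat_le_iff P_def Q_def)
  also have "\<dots> = 2 ^ card I * real P * real m" by simp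
  also have "\<dots> \<le> 2 ^ card I * real P * (real t / real Q + 1)"
    by (intro mult_left_mono m) simp
  also have "\<dots> = a + 2 ^ card I * (\<Prod>i\<in>I. real (n i))"
    by (simp add: a P_def algebra_simps)
  finally show "real (\<pi>\<^sup>* t H) \<le> a + 2 ^ card I * (\<Prod>i\<in>I. real (n i))" .
qed

end

theorem theorem3p15:
  fixes d :: nat and n :: "nat \<Rightarrow> nat" and G :: "nat \<Rightarrow> 'a pair_pre_digraph"
  assumes "1 \<le> d"
    and "\<And>i. i \<in> {1..d} \<Longrightarrow> 1 \<le> n i"
    and "\<And>i. i \<in> {1..d} \<Longrightarrow> complete_digraph (n i) (with_proj (G i))"
  shows "\<exists>C::real. \<forall>t::nat.
    \<bar>real (\<pi>\<^sup>* t (cartesian_product {1..d} G))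
      - 2 ^ d * real t * (\<Prod>i = 1..d. real (n i) / (real (n i) + 1))\<bar> \<le> C"
proof -
  interpret complete_product "{1..d}" G n
    using assms(3) by unfold_locales simp_all
  show ?thesis
    using optimal_pebbling_number_bounds
    \<comment> \<open>The witness is the rounding error of the upper bound; the lower bound is
      exact.\<close>
    by (intro exI[of _ "2 ^ d * (\<Prod>i = 1..d. real (n i))"]) (simp add: abs_le_iff algebra_simps)
qed

end
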